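(* Let $\gamma>0$. For every $c\in\mathbb{R}$, there is no nontrivial (i.e. not identically zero) solution $\varphi\in C^2(\mathbb{R})$ of the differential equation $$(c-\varphi(x))\varphi''(x)=(\varphi'(x))^2-\gamma\varphi(x),\quad x\in\mathbb{R},$$ satisfying $\lim_{|x|\to\infty}\varphi(x)=\lim_{|x|\to\infty}\varphi'(x)=0$.
   Context: $\varphi$ is real-valued. The equation is the one satisfied by traveling waves $u(t,x)=\varphi(x-ct)$ of $(u_t+uu_x)_x=\gamma u$. *)

theory Defs
  imports "HOL-Analysis.Analysis"
begin

text \<open>
  The space \<open>C\<^sup>2(\<real>)\<close> of twice continuously differentiable real functions. Since \<open>deriv\<close> is total,
  differentiability has to be required explicitly; continuity of \<open>f\<close> and \<open>deriv f\<close> follows from it.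
\<close>

definition C2 :: "(real \<Rightarrow> real) set" where
  "C2 = {f. (\<forall>x. f field_differentiable at x) \<and> (\<forall>x. deriv f field_differentiable at x)
            \<and> continuous_on UNIV (deriv (deriv f))}"

end

theory Submission
  imports Defs
begin

text \<open>
  Multiplying the equation by \<open>(c - \<phi>) \<phi>'\<close> and integrating from infinity gives the first integral
  \<open>(c - \<phi>)\<^sup>2 \<phi>'\<^sup>2 = \<gamma> \<phi>\<^sup>2 (2\<phi>/3 - c)\<close>. If \<open>\<phi>\<close> is not identically zero, then \<open>\<bar>\<phi>\<bar>\<close> attains a positive
  maximum, at a critical point of \<open>\<phi>\<close>; there the first integral forces \<open>\<phi> = 3c/2\<close>, with
  \<open>c \<noteq> 0\<close>. On its way from this value to the limit \<open>0\<close> the function must take the value \<open>c\<close>, where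
  the first integral reads \<open>0 = - \<gamma> c\<^sup>3 / 3\<close>, a contradiction.
\<close>

text \<open>Outside a large closed ball \<open>\<bar>f\<bar>\<close> stays below
  \<open>\<bar>f x0\<bar>\<close>, so its maximum over this compact ball is global.\<close>

lemma attains_abs_max_of_tendsto_0:
  fixes f :: "real \<Rightarrow> real"
  assumes cont: "continuous_on UNIV f" and lim: "(f \<longlongrightarrow> 0) at_infinity" and nz: "f x0 \<noteq> 0"
  obtains p where "f p \<noteq> 0" "\<And>x. \<bar>f x\<bar> \<le> \<bar>f p\<bar>"
proof -
  have "\<forall>\<^sub>F x in at_infinity. dist (f x) 0 < \<bar>f x0\<bar>"
    using tendstoD[OF lim, of "\<bar>f x0\<bar>"] nz by simp
  then obtain b where b: "\<And>x. b \<le> norm x \<Longrightarrow> \<bar>f x\<bar> < \<bar>f x0\<bar>"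
    unfolding eventually_at_infinity by auto
  \<comment> \<open>Otherwise \<open>b\<close> would give
    \<open>\<bar>f x0\<bar> < \<bar>f x0\<bar>\<close>. This also makes the ball nonempty.\<close>
  have "x0 \<in> cball 0 b"
    using b[of x0] by force
  moreover have "continuous_on (cball 0 b) (\<lambda>x. \<bar>f x\<bar>)"
    using cont by (intro continuous_intros) (rule continuous_on_subset, auto)
  ultimately obtain p where p: "\<And>x. x \<in> cball 0 b \<Longrightarrow> \<bar>f x\<bar> \<le> \<bar>f p\<bar>"
    using continuous_attains_sup[of "cball 0 b" "\<lambda>x. \<bar>f x\<bar>"] by (metis compact_cball empty_iff)
  have x0p: "\<bar>f x0\<bar> \<le> \<bar>f p\<bar>"
    using p \<open>x0 \<in> cball 0 b\<close> by blast
  have "\<bar>f x\<bar> \<le> \<bar>f p\<bar>" for x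
    using p[of x] b[of x] x0p by (cases "x \<in> cball 0 b") auto
  moreover have "f p \<noteq> 0"
    using x0p nz by auto
  ultimately show ?thesis
    using that by blast
qed

text \<open>Squaring turns a maximum of \<open>\<bar>f\<bar>\<close> into one of a function
  differentiable at \<open>p\<close>, whatever the sign of \<open>f p\<close>; Fermat's criterion
  then applies.\<close>

lemma deriv_eq_0_at_abs_max:
  fixes f :: "real \<Rightarrow> real"
  assumes f: "(f has_real_derivative d) (at p)"
    and max: "\<And>x. \<bar>f x\<bar> \<le> \<bar>f p\<bar>" and nz: "f p \<noteq> 0"
  shows "d = 0"
proof -
  have "((\<lambda>x. (f x)\<^sup>2) has_real_derivative 2 * f p * d) (at p)"
    by (auto intro!: derivative_eq_intros f)
  moreover have "(f x)\<^sup>2 \<le> (f p)\<^sup>2" for x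
    using max[of x] by (simp add: abs_le_square_iff)
  ultimately have "2 * f p * d = 0"
    using DERIV_local_max[of "\<lambda>x. (f x)\<^sup>2" _ p 1] by (metis zero_less_one)
  with nz show ?thesis by simp
qed

lemma constant_eq_limit_at_infinity:
  fixes f :: "real \<Rightarrow> real"
  assumes "\<And>x. (f has_real_derivative 0) (at x)" and lim: "(f \<longlongrightarrow> l) at_infinity"
  shows "f x = l"
proof -
  have "f = (\<lambda>_. f x)"
    using DERIV_isconst_all[of f] assms(1) by blast
  with lim have "((\<lambda>_::real. f x) \<longlongrightarrow> l) at_infinity"
    by metis
  then show ?thesis
    by (simp add: tendsto_const_iff trivial_limit_at_infinity)
qed

text \<open>Nothing is divided by \<open>c - \<phi> x\<close>, so the identity survives at points
  where \<open>\<phi>\<close> equals \<open>c\<close>, the very points that yield the final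
  contradiction.\<close>

lemma first_integral:
  fixes \<phi> \<phi>' \<phi>'' :: "real \<Rightarrow> real"
  assumes d1: "\<And>x. (\<phi> has_real_derivative \<phi>' x) (at x)"
    and d2: "\<And>x. (\<phi>' has_real_derivative \<phi>'' x) (at x)"
    and ode: "\<And>x. (c - \<phi> x) * \<phi>'' x = (\<phi>' x)\<^sup>2 - \<gamma> * \<phi> x"
    and lim: "(\<phi> \<longlongrightarrow> 0) at_infinity" and lim': "(\<phi>' \<longlongrightarrow> 0) at_infinity"
  shows "((c - \<phi> x) * \<phi>' x)\<^sup>2 = \<gamma> * (\<phi> x)\<^sup>2 * (2 * \<phi> x / 3 - c)"
proof -
  let ?E = "\<lambda>x. ((c - \<phi> x) * \<phi>' x)\<^sup>2 - \<gamma> * (\<phi> x)\<^sup>2 * (2 * \<phi> x / 3 - c)"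
  have "(?E has_real_derivative 0) (at y)" for y
  proof -
    \<comment> \<open>The derivative is factored so that its last factor is the difference of the
      two sides of the equation.\<close>
    have "(?E has_real_derivative
        2 * (c - \<phi> y) * \<phi>' y * ((c - \<phi> y) * \<phi>'' y - ((\<phi>' y)\<^sup>2 - \<gamma> * \<phi> y))) (at y)"
      by (auto intro!: derivative_eq_intros d1 d2 simp: algebra_simps power2_eq_square)
    then show ?thesis by (simp add: ode)
  qed
  moreover have "(?E \<longlongrightarrow> ((c - 0) * 0)\<^sup>2 - \<gamma> * 0\<^sup>2 * (2 * 0 / 3 - c)) at_infinity"
    by (intro tendsto_intros lim lim') auto
  ultimately have "?E x = ((c - 0) * 0)\<^sup>2 - \<gamma> * 0\<^sup>2 * (2 * 0 / 3 - c)"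
    by (rule constant_eq_limit_at_infinity)
  then show ?thesis by simp
qed

lemma attains_intermediate_of_tendsto_0:
  fixes f :: "real \<Rightarrow> real"
  assumes cont: "continuous_on UNIV f" and lim: "(f \<longlongrightarrow> 0) at_infinity"
    and c: "c \<noteq> 0" "\<bar>f p\<bar> \<ge> \<bar>c\<bar>" "f p * c > 0"
  shows "\<exists>y. f y = c"
proof -
  have "\<forall>\<^sub>F x in at_infinity. dist (f x) 0 < \<bar>c\<bar>"
    using tendstoD[OF lim, of "\<bar>c\<bar>"] c by simp
  then obtain b where "\<And>x. b \<le> norm x \<Longrightarrow> \<bar>f x\<bar> < \<bar>c\<bar>"
    unfolding eventually_at_infinity by auto
  \<comment> \<open>The bound itself serves as a far point, since \<open>b \<le> norm b\<close> for
    either sign of \<open>b\<close>.\<close>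
  from this[of b] have q: "\<bar>f b\<bar> < \<bar>c\<bar>" by simp
  have "connected (range f)"
    using cont by (intro connected_continuous_image) auto
  then have iv: "is_interval (range f)"
    by (simp add: is_interval_connected_1)
  \<comment> \<open>The first case is \<open>c > 0\<close>, the second \<open>c < 0\<close>;
    \<open>f p\<close> has the sign of \<open>c\<close>.\<close>
  have "f b \<le> c \<and> c \<le> f p \<or> f p \<le> c \<and> c \<le> f b"
    using q c by (auto simp: zero_less_mult_iff)
  with iv have "c \<in> range f"
    unfolding is_interval_1 by blast
  then show ?thesis by auto
qed

theorem theorem6:
  fixes \<gamma> :: real
  assumes "\<gamma> > 0"
  shows "\<forall>c::real. \<not> (\<exists>\<phi> \<in> C2.
           \<phi> \<noteq> (\<lambda>x. 0)
         \<and> (\<forall>x. (c - \<phi> x) * deriv (deriv \<phi>) x = (deriv \<phi> x)\<^sup>2 - \<gamma> * \<phi> x)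
         \<and> (\<phi> \<longlongrightarrow> 0) at_infinity
         \<and> (deriv \<phi> \<longlongrightarrow> 0) at_infinity)"
proof (intro allI notI, elim bexE conjE)
  fix c :: real and \<phi> :: "real \<Rightarrow> real"
  assume "\<phi> \<in> C2" and nz: "\<phi> \<noteq> (\<lambda>x. 0)"
    and ode: "\<forall>x. (c - \<phi> x) * deriv (deriv \<phi>) x = (deriv \<phi> x)\<^sup>2 - \<gamma> * \<phi> x"
    and lim: "(\<phi> \<longlongrightarrow> 0) at_infinity" and lim': "(deriv \<phi> \<longlongrightarrow> 0) at_infinity"
  have d1: "(\<phi> has_real_derivative deriv \<phi> x) (at x)"
    and d2: "(deriv \<phi> has_real_derivative deriv (deriv \<phi>) x) (at x)" for x
    using \<open>\<phi> \<in> C2\<close> by (auto simp: C2_def field_differentiable_derivI)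
  have cont: "continuous_on UNIV \<phi>"
    using d1 DERIV_isCont by (blast intro: continuous_at_imp_continuous_on)
  have E: "((c - \<phi> x) * deriv \<phi> x)\<^sup>2 = \<gamma> * (\<phi> x)\<^sup>2 * (2 * \<phi> x / 3 - c)" for x
    using first_integral[OF d1 d2 _ lim lim'] ode by blast
  obtain x0 where "\<phi> x0 \<noteq> 0" using nz by auto
  then obtain p where p: "\<phi> p \<noteq> 0" "\<And>x. \<bar>\<phi> x\<bar> \<le> \<bar>\<phi> p\<bar>"
    using attains_abs_max_of_tendsto_0[OF cont lim] by blast
  have "deriv \<phi> p = 0"
    using deriv_eq_0_at_abs_max[OF d1 p(2) p(1)] .
  \<comment> \<open>The left side of \<open>E\<close> vanishes at \<open>p\<close>, and the nonzero
    factor \<open>\<gamma> * (\<phi> p)\<^sup>2\<close> cancels.\<close>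
  with E[of p] p(1) \<open>\<gamma> > 0\<close> have \<phi>p: "\<phi> p = 3 * c / 2"
    by simp
  with p(1) have "c \<noteq> 0" by simp
  \<comment> \<open>The product is 3/2 times the square of \<open>c\<close>.\<close>
  moreover from this have "\<phi> p * c > 0"
    by (simp add: \<phi>p flip: power2_eq_square)
  moreover have "\<bar>\<phi> p\<bar> \<ge> \<bar>c\<bar>"
    by (simp add: \<phi>p)
  ultimately obtain y where "\<phi> y = c"
    using attains_intermediate_of_tendsto_0[OF cont lim] by blast
  with E[of y] \<open>\<gamma> > 0\<close> \<open>c \<noteq> 0\<close> show False
    by simp
qed

end
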